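(* Consider the downlink of a multi-cell Massive MIMO system with $L$ cells and $K$ users per cell, coherence intervals of $\tau_c$ symbols of which $\tau_p$ are used for uplink pilots, and received downlink signals at user $k$ in cell $l$ $$y_{lk}[n]=\sum_{l'=1}^{L}\sum_{k'=1}^{K}\sqrt{\eta_{l'k'}}\,\alpha_{lk}^{l'k'}\,s_{l'k'}[n]+\tilde w_{lk}[n],\qquad n=1,\dots,\tau_c-\tau_p .$$ Let $$\xi_{lk}=\frac{1}{\tau_c-\tau_p}\sum_{n=1}^{\tau_c-\tau_p}\bigl|y_{lk}[n]\bigr|^2 .$$ Then, as $\tau_c\to\infty$ for fixed $\tau_p$, conditionally on the channel realizations (i.e. for given values of all $\alpha_{lk}^{l'k'}$, with the randomness being that of the data symbols and the noise), $$\xi_{lk}\xrightarrow{P}\eta_{lk}\bigl|\alpha_{lk}^{lk}\bigr|^2+\sum_{\substack{k'=1\\k'\neq k}}^{K}\eta_{lk'}\bigl|\alpha_{lk}^{lk'}\bigr|^2+\sum_{\substack{l'=1\\l'\neq l}}^{L}\sum_{k'=1}^{K}\eta_{l'k'}\bigl|\alpha_{lk}^{l'k'}\bigr|^2+\sigma_{\mathrm{DL}}^2 .$$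
   Context: BS $l$ has $M$ antennas; $\mathbf g_{lk}^{l'}\in\mathbb C^M$ is the random channel between BS $l'$ and user $k$ in cell $l$, and $\mathbf w_{l'k'}\in\mathbb C^M$ is the precoding vector used by BS $l'$ for its user $k'$ (a function of the channel estimates). All of these are constant within a coherence interval. The effective downlink channel gains are $\alpha_{lk}^{l'k'}=\sqrt{\rho_{\rm dl}}\,(\mathbf g_{lk}^{l'})^{\rm H}\mathbf w_{l'k'}$, where $\rho_{\rm dl}>0$ is the maximum downlink power, and $\eta_{l'k'}\in[0,1]$ are fixed power coefficients with $\sum_{k'}\eta_{l'k'}\le 1$ for every $l'$. The data symbols $s_{l'k'}[n]$ have zero mean and $\mathbb E\{|s_{l'k'}[n]|^2\}=1$, are identically distributed over $n$, and are mutually independent over all $(l',k',n)$. The noise samples $\tilde w_{lk}[n]\sim\mathcal{CN}(0,\sigma_{\mathrm{DL}}^2)$ are independent over $n$. Data symbols and noise are independent of each other and of the channels (and hence of the $\alpha_{lk}^{l'k'}$). $\xrightarrow{P}$ denotes convergence in probability. *)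

theory Defs
  imports "HOL-Probability.Probability"
begin

text \<open>
  Cells are the elements of a finite type \<open>'c\<close> (so \<open>L = CARD('c)\<close>), the users of a cell those of
  a finite type \<open>'u\<close> (so \<open>K = CARD('u)\<close>), and the antennas of a base station those of a finite
  type \<open>'m\<close>. Argument order: \<open>g l' l k\<close> is the channel between base station \<open>l'\<close> and user \<open>k\<close>
  of cell \<open>l\<close>; \<open>\<eta> l' k'\<close> and \<open>s l' k' n\<close> belong to user \<open>k'\<close> of cell \<open>l'\<close>. The random
  processes are indexed by \<open>n \<in> {1..}\<close>; their values at \<open>n = 0\<close> are never used.
\<close>

definition effective_gain :: "real \<Rightarrow> complex ^ 'm::finite \<Rightarrow> complex ^ 'm \<Rightarrow> complex" where
  "effective_gain \<rho> g w = complex_of_real (sqrt \<rho>) * (\<Sum>i\<in>UNIV. cnj (g $ i) * w $ i)"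

text \<open>
  The gains \<open>a l' k'\<close> are those seen by one fixed user. They are functions on the sample space, so
  that both random gains and given (constant) gains can be inserted.
\<close>

definition received ::
  "('c::finite \<Rightarrow> 'u::finite \<Rightarrow> real) \<Rightarrow> ('c \<Rightarrow> 'u \<Rightarrow> 'a \<Rightarrow> complex) \<Rightarrow>
   ('c \<Rightarrow> 'u \<Rightarrow> nat \<Rightarrow> 'a \<Rightarrow> complex) \<Rightarrow> (nat \<Rightarrow> 'a \<Rightarrow> complex) \<Rightarrow> nat \<Rightarrow> 'a \<Rightarrow> complex" where
  "received \<eta> a s v n \<omega> =
     (\<Sum>l'\<in>UNIV. \<Sum>k'\<in>UNIV. complex_of_real (sqrt (\<eta> l' k')) * a l' k' \<omega> * s l' k' n \<omega>) + v n \<omega>"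

definition mean_received_power :: "nat \<Rightarrow> (nat \<Rightarrow> 'a \<Rightarrow> complex) \<Rightarrow> nat \<Rightarrow> 'a \<Rightarrow> real" where
  "mean_received_power \<tau>p y \<tau>c \<omega> =
     1 / real (\<tau>c - \<tau>p) * (\<Sum>n = 1..\<tau>c - \<tau>p. (cmod (y n \<omega>))\<^sup>2)"

definition limit_power ::
  "('c::finite \<Rightarrow> 'u::finite \<Rightarrow> real) \<Rightarrow> ('c \<Rightarrow> 'u \<Rightarrow> 'a \<Rightarrow> complex) \<Rightarrow> real \<Rightarrow> 'c \<Rightarrow> 'u \<Rightarrow> 'a \<Rightarrow> real" where
  "limit_power \<eta> a \<sigma> l k \<omega> =
     \<eta> l k * (cmod (a l k \<omega>))\<^sup>2
     + (\<Sum>k'\<in>UNIV - {k}. \<eta> l k' * (cmod (a l k' \<omega>))\<^sup>2)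
     + (\<Sum>l'\<in>UNIV - {l}. \<Sum>k'\<in>UNIV. \<eta> l' k' * (cmod (a l' k' \<omega>))\<^sup>2)
     + \<sigma>\<^sup>2"

text \<open>
  The circularly symmetric complex Gaussian law with \<open>E |Z|\<^sup>2 = v\<close>: real and imaginary part are
  independent \<open>N(0, v/2)\<close>. For \<open>v = 0\<close> it is the point mass at 0.
\<close>

definition complex_normal :: "real \<Rightarrow> complex measure" where
  "complex_normal v =
     distr (density lborel (\<lambda>x. ennreal (std_normal_density x)) \<Otimes>\<^sub>M
            density lborel (\<lambda>x. ennreal (std_normal_density x))) borel
       (\<lambda>(x, y). Complex (sqrt (v / 2) * x) (sqrt (v / 2) * y))"

definition tendsto_in_prob ::
  "'a measure \<Rightarrow> (nat \<Rightarrow> 'a \<Rightarrow> real) \<Rightarrow> ('a \<Rightarrow> real) \<Rightarrow> bool" where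
  "tendsto_in_prob M X Y \<longleftrightarrow>
     (\<forall>t. X t \<in> borel_measurable M) \<and> Y \<in> borel_measurable M \<and>
     (\<forall>\<epsilon>>0. (\<lambda>t. measure M {\<omega> \<in> space M. \<bar>X t \<omega> - Y \<omega>\<bar> > \<epsilon>}) \<longlonglongrightarrow> 0)"

text \<open>
  Convergence in probability conditionally on the \<open>\<sigma>\<close>-algebra \<open>F\<close>: the conditional probabilities
  of the deviation events, given \<open>F\<close>, tend to 0 almost surely. The exceptional null set may depend
  on \<open>\<epsilon>\<close>, since conditional probabilities are only determined up to null sets.
\<close>

definition cond_tendsto_in_prob ::
  "'a measure \<Rightarrow> 'a measure \<Rightarrow> (nat \<Rightarrow> 'a \<Rightarrow> real) \<Rightarrow> ('a \<Rightarrow> real) \<Rightarrow> bool" where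
  "cond_tendsto_in_prob M F X Y \<longleftrightarrow>
     subalgebra M F \<and>
     (\<forall>t. X t \<in> borel_measurable M) \<and> Y \<in> borel_measurable M \<and>
     (\<forall>\<epsilon>>0. AE \<omega> in M.
        (\<lambda>t. real_cond_exp M F (indicator {\<omega>' \<in> space M. \<bar>X t \<omega>' - Y \<omega>'\<bar> > \<epsilon>}) \<omega>) \<longlonglongrightarrow> 0)"

text \<open>
  The following are the \<open>\<sigma>\<close>-algebras generated by all symbols (respectively all noise samples) and
  by all channels together with all channel estimates.
\<close>

definition process_algebra ::
  "'a measure \<Rightarrow> ('c::finite \<Rightarrow> 'u::finite \<Rightarrow> nat \<Rightarrow> 'a \<Rightarrow> complex) \<Rightarrow> 'a measure" where
  "process_algebra M s =
     vimage_algebra (space M) (\<lambda>\<omega>. restrict (\<lambda>(l, k, n). s l k n \<omega>) (UNIV \<times> UNIV \<times> {1..}))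
       (PiM (UNIV \<times> UNIV \<times> {1..}) (\<lambda>_. borel))"

definition all_links ::
  "('c::finite \<Rightarrow> 'c \<Rightarrow> 'u::finite \<Rightarrow> 'a \<Rightarrow> complex ^ 'm::finite) \<Rightarrow> 'a \<Rightarrow> 'c \<times> 'c \<times> 'u \<Rightarrow> complex ^ 'm" where
  "all_links g \<omega> = (\<lambda>(l', l, k). g l' l k \<omega>)"

definition channel_algebra ::
  "'a measure \<Rightarrow> ('c::finite \<Rightarrow> 'c \<Rightarrow> 'u::finite \<Rightarrow> 'a \<Rightarrow> complex ^ 'm::finite) \<Rightarrow>
   ('c \<Rightarrow> 'c \<Rightarrow> 'u \<Rightarrow> 'a \<Rightarrow> complex ^ 'm) \<Rightarrow> 'a measure" where
  "channel_algebra M g ghat =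
     vimage_algebra (space M) (\<lambda>\<omega>. (all_links g \<omega>, all_links ghat \<omega>))
       (PiM UNIV (\<lambda>_. borel) \<Otimes>\<^sub>M PiM UNIV (\<lambda>_. borel))"

end

theory Submission
  imports Defs
begin

text \<open>
  Write the received sample as \<open>y[n] = \<Sum>\<^sub>p c\<^sub>p Z\<^sub>p[n]\<close>, where \<open>p\<close> runs over all symbol streams and the noise.
  Then \<open>\<xi>\<close> is the quadratic form with coefficients \<open>c\<^sub>p cnj c\<^sub>q\<close> in the time averages of \<open>Z\<^sub>p[n] cnj Z\<^sub>q[n]\<close>.
  For each \<open>(p, q)\<close> these products are i.i.d. and integrable, so an \<open>L\<^sup>1\<close> weak law applies; no
  fourth moments exist in general, hence truncation. The error is at most \<open>W S\<close>, where \<open>W\<close> depends only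
  on the gains, and \<open>S\<close> tends to 0 in \<open>L\<^sup>1\<close> and is independent of the channels. Conditionally
  on the channels \<open>W\<close> is a constant, and Markov's inequality for \<open>S\<close> finishes the proof.
\<close>

section \<open>Measurability, the Gaussian second moment and a deterministic quadratic-form
  bound\<close>

lemma borel_measurable_cnj [measurable]: "cnj \<in> borel_measurable borel"
  by (intro borel_measurable_continuous_onI continuous_intros)

text \<open>The sample is a coordinate of the map that generates the algebra. That map records only
  the indices from 1 on, hence the assumption on \<open>n\<close>.\<close>

lemma borel_measurable_process_algebra:
  assumes "n \<ge> 1"
  shows "s l k n \<in> borel_measurable (process_algebra M s)"
proof -
  let ?P = "PiM (UNIV \<times> UNIV \<times> {1..}) (\<lambda>_. borel :: complex measure)"
  have "(\<lambda>\<omega>. restrict (\<lambda>(l, k, n). s l k n \<omega>) (UNIV \<times> UNIV \<times> {1..})) \<in> measurable (process_algebra M s) ?P"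
    unfolding process_algebra_def
    by (rule measurable_vimage_algebra1) (auto simp: space_PiM)
  moreover have "(\<lambda>x. x (l, k, n)) \<in> measurable ?P borel"
    by (rule measurable_component_singleton) (use assms in auto)
  ultimately have "(\<lambda>\<omega>. restrict (\<lambda>(l, k, n). s l k n \<omega>) (UNIV \<times> UNIV \<times> {1..}) (l, k, n))
      \<in> borel_measurable (process_algebra M s)"
    by (rule measurable_compose)
  then show ?thesis
    using assms by simp
qed

text \<open>The squared modulus is \<open>v / 2\<close> times a sum of two squares of standard
  normal variables, each with second moment 1. Computing with nonnegative integrals yields
  integrability and the value at once.\<close>

lemma complex_normal_second_moment:
  assumes "v \<ge> 0"
  shows "has_bochner_integral (complex_normal v) (\<lambda>z. (cmod z)\<^sup>2) v"
proof -
  let ?N = "density lborel (\<lambda>x. ennreal (std_normal_density x))"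
  interpret N: prob_space ?N
    by (rule prob_space_normal_density) simp
  have one: "(\<integral>\<^sup>+x. ennreal (x\<^sup>2) \<partial>?N) = 1"
    using std_normal_distribution_even_moments[of 1] by (subst nn_integral_eq_integral) auto
  have "(\<integral>\<^sup>+z. ennreal ((cmod z)\<^sup>2) \<partial>complex_normal v)
      = (\<integral>\<^sup>+p. ennreal ((cmod (case p of (x, y) \<Rightarrow> Complex (sqrt (v / 2) * x) (sqrt (v / 2) * y)))\<^sup>2) \<partial>(?N \<Otimes>\<^sub>M ?N))"
    unfolding complex_normal_def
    by (rule nn_integral_distr) (auto simp: Complex_eq measurable_split_conv)
  also have "\<dots> = (\<integral>\<^sup>+p. ennreal (v / 2) * (ennreal ((fst p)\<^sup>2) + ennreal ((snd p)\<^sup>2)) \<partial>(?N \<Otimes>\<^sub>M ?N))"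
    using assms by (intro nn_integral_cong)
      (auto simp: cmod_power2 power_mult_distrib ennreal_plus[symmetric] ennreal_mult'[symmetric] algebra_simps
        simp del: ennreal_plus)
  also have "\<dots> = ennreal (v / 2) * ((\<integral>\<^sup>+p. ennreal ((fst p)\<^sup>2) \<partial>(?N \<Otimes>\<^sub>M ?N)) + (\<integral>\<^sup>+p. ennreal ((snd p)\<^sup>2) \<partial>(?N \<Otimes>\<^sub>M ?N)))"
    by (subst nn_integral_cmult, simp, subst nn_integral_add) auto
  also have "(\<integral>\<^sup>+p. ennreal ((fst p)\<^sup>2) \<partial>(?N \<Otimes>\<^sub>M ?N)) = (\<integral>\<^sup>+x. \<integral>\<^sup>+y. ennreal (x\<^sup>2) \<partial>?N \<partial>?N)"
    by (subst N.nn_integral_fst[symmetric]) auto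
  also have "\<dots> = 1" using one N.emeasure_space_1 by simp
  also have "(\<integral>\<^sup>+p. ennreal ((snd p)\<^sup>2) \<partial>(?N \<Otimes>\<^sub>M ?N)) = (\<integral>\<^sup>+x. \<integral>\<^sup>+y. ennreal (y\<^sup>2) \<partial>?N \<partial>?N)"
    by (subst N.nn_integral_fst[symmetric]) auto
  also have "\<dots> = 1" using one N.emeasure_space_1 by simp
  also have "ennreal (v / 2) * (1 + 1) = ennreal v"
    using assms by (metis ennreal_mult'' ennreal_numeral field_sum_of_halves mult.commute mult_2 one_add_one zero_le_numeral)
  finally show ?thesis
    using assms by (intro has_bochner_integral_nn_integral) (auto simp: complex_normal_def)
qed

text \<open>Both terms are quadratic forms in \<open>c\<close>: one with the matrix of sample
  correlations of \<open>z\<close>, the other with the diagonal matrix of the \<open>P p\<close>.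
  Bounding the difference by a product separates the coefficients from the samples. With division by
  zero equal to 0, the estimate also covers \<open>N = 0\<close>.\<close>

lemma mean_square_norm_sum_bound:
  fixes c :: "'p :: finite \<Rightarrow> complex" and z :: "'p \<Rightarrow> nat \<Rightarrow> complex" and P :: "'p \<Rightarrow> real"
  shows "\<bar>1 / real N * (\<Sum>n=1..N. (cmod (\<Sum>p\<in>UNIV. c p * z p n))\<^sup>2) - (\<Sum>p\<in>UNIV. (cmod (c p))\<^sup>2 * P p)\<bar>
    \<le> (\<Sum>p\<in>UNIV. \<Sum>q\<in>UNIV. cmod (c p * cnj (c q))) *
      (\<Sum>p\<in>UNIV. \<Sum>q\<in>UNIV. cmod ((\<Sum>n=1..N. z p n * cnj (z q n)) / of_nat N - (if p = q then of_real (P p) else 0)))"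
    (is "\<bar>?l\<bar> \<le> _")
proof -
  \<comment> \<open>\<open>R\<close> is the entrywise error of the sample correlation matrix,
    \<open>d\<close> the matrix of coefficient products. The pairs are taken as one index, so that
    only single sums have to be estimated.\<close>
  define R where "R = (\<lambda>(p, q). (\<Sum>n=1..N. z p n * cnj (z q n)) / of_nat N - (if p = q then of_real (P p) else 0))"
  define d where "d = (\<lambda>(p, q). c p * cnj (c q))"
  have "complex_of_real (1 / real N * (\<Sum>n=1..N. (cmod (\<Sum>p\<in>UNIV. c p * z p n))\<^sup>2))
      = (\<Sum>n=1..N. \<Sum>p\<in>UNIV. \<Sum>q\<in>UNIV. (c p * z p n) * cnj (c q * z q n)) / of_nat N"
    by (simp add: complex_norm_square sum_product del: of_real_power)
  also have "\<dots> = (\<Sum>p\<in>UNIV. \<Sum>q\<in>UNIV. \<Sum>n=1..N. (c p * z p n) * cnj (c q * z q n)) / of_nat N"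
    by (subst sum.swap, subst (2) sum.swap) simp
  also have "\<dots> = (\<Sum>p\<in>UNIV. \<Sum>q\<in>UNIV. c p * cnj (c q) * ((\<Sum>n=1..N. z p n * cnj (z q n)) / of_nat N))"
    by (simp add: sum_divide_distrib sum_distrib_left mult_ac)
  finally have 1: "complex_of_real (1 / real N * (\<Sum>n=1..N. (cmod (\<Sum>p\<in>UNIV. c p * z p n))\<^sup>2)) = \<dots>" .
  have 2: "complex_of_real (\<Sum>p\<in>UNIV. (cmod (c p))\<^sup>2 * P p)
      = (\<Sum>p\<in>UNIV. \<Sum>q\<in>UNIV. c p * cnj (c q) * (if p = q then of_real (P p) else 0))"
    by (simp add: complex_norm_square if_distrib[of "(*) _"] cong: if_cong del: of_real_power)
  have "complex_of_real ?l = (\<Sum>pq\<in>UNIV. d pq * R pq)"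
    unfolding of_real_diff 1 2 R_def d_def
    by (simp add: sum_subtractf[symmetric] right_diff_distrib sum.cartesian_product case_prod_unfold
        flip: UNIV_Times_UNIV)
  then have "\<bar>?l\<bar> = cmod (\<Sum>pq\<in>UNIV. d pq * R pq)"
    by (simp only: norm_of_real flip: \<open>complex_of_real ?l = _\<close>)
  also have "\<dots> \<le> (\<Sum>pq\<in>UNIV. cmod (d pq) * cmod (R pq))"
    by (rule norm_sum[THEN order_trans]) (simp add: norm_mult)
  \<comment> \<open>Each \<open>cmod (d pq)\<close> is replaced by the sum of all of them; this
    crude step is what makes the bound a product.\<close>
  also have "\<dots> \<le> (\<Sum>pq\<in>UNIV. (\<Sum>pq\<in>UNIV. cmod (d pq)) * cmod (R pq))"
    by (intro sum_mono mult_right_mono member_le_sum) auto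
  also have "\<dots> = (\<Sum>pq\<in>UNIV. cmod (d pq)) * (\<Sum>pq\<in>UNIV. cmod (R pq))"
    by (simp add: sum_distrib_left)
  finally show ?thesis
    by (simp add: R_def d_def sum.cartesian_product case_prod_unfold flip: UNIV_Times_UNIV)
qed

context prob_space
begin

subsection \<open>Independence\<close>

lemma indep_sets_reindex:
  assumes ind: "indep_sets F (h ` I)" and inj: "inj_on h I"
  shows "indep_sets (\<lambda>i. F (h i)) I"
proof (rule indep_setsI)
  fix i assume "i \<in> I" then show "F (h i) \<subseteq> events"
    using ind by (auto simp: indep_sets_def)
next
  fix A J assume J: "J \<noteq> {}" "J \<subseteq> I" "finite J" "\<forall>j\<in>J. A j \<in> F (h j)"
  have inv: "the_inv_into I h (h j) = j" if "j \<in> J" for j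
    using inj J that by (auto intro: the_inv_into_f_f)
  have "prob (\<Inter>i\<in>h ` J. A (the_inv_into I h i)) = (\<Prod>i\<in>h ` J. prob (A (the_inv_into I h i)))"
    using J inv by (intro indep_setsD[OF ind]) auto
  also have "(\<Inter>i\<in>h ` J. A (the_inv_into I h i)) = (\<Inter>j\<in>J. A j)"
    using inv by auto
  also have "(\<Prod>i\<in>h ` J. prob (A (the_inv_into I h i))) = (\<Prod>j\<in>J. prob (A j))"
    using inv inj_on_subset[OF inj J(2)] by (simp add: prod.reindex)
  finally show "prob (\<Inter>j\<in>J. A j) = (\<Prod>j\<in>J. prob (A j))" .
qed

lemma indep_vars_reindex:
  assumes "indep_vars N X (h ` I)" "inj_on h I"
  shows "indep_vars (\<lambda>i. N (h i)) (\<lambda>i. X (h i)) I"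
  using assms indep_sets_reindex unfolding indep_vars_def2 by fastforce

text \<open>A finite intersection splits into a part over \<open>I1\<close>, which lies in
  \<open>A\<close>, and a part over \<open>I2\<close>, which lies in \<open>B\<close>. Independence
  of \<open>A\<close> and \<open>B\<close> factors its probability, and independence within each
  family factors the two parts.\<close>

lemma indep_vars_Un:
  assumes X1: "indep_vars N X I1" and X2: "indep_vars N X I2" and disj: "I1 \<inter> I2 = {}"
    and sp: "space A = space M" "space B = space M"
    and ind: "indep_set (sets A) (sets B)"
    and A: "\<And>i. i \<in> I1 \<Longrightarrow> X i \<in> measurable A (N i)"
    and B: "\<And>i. i \<in> I2 \<Longrightarrow> X i \<in> measurable B (N i)"
  shows "indep_vars N X (I1 \<union> I2)"
  unfolding indep_vars_def2
proof (intro conjI ballI indep_setsI)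
  fix i assume "i \<in> I1 \<union> I2" then show "X i \<in> measurable M (N i)"
    using X1 X2 by (auto simp: indep_vars_def2)
next
  fix i assume "i \<in> I1 \<union> I2"
  then have "X i \<in> measurable M (N i)"
    using X1 X2 by (auto simp: indep_vars_def2)
  then show "{X i -` C \<inter> space M |C. C \<in> sets (N i)} \<subseteq> events"
    by auto
next
  fix E J
  assume J: "J \<noteq> {}" "J \<subseteq> I1 \<union> I2" "finite J"
    and E: "\<forall>j\<in>J. E j \<in> {X j -` C \<inter> space M |C. C \<in> sets (N j)}"
  have E_sp: "E j \<subseteq> space M" if "j \<in> J" for j using E that by auto
  \<comment> \<open>Intersecting with \<open>space M\<close> handles an empty \<open>J'\<close>,
    whose bare intersection would be \<open>UNIV\<close>. This occurs when \<open>J\<close> lies in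
    only one of the two index sets.\<close>
  have prod: "prob (space M \<inter> (\<Inter>j\<in>J'. E j)) = (\<Prod>j\<in>J'. prob (E j))"
    if "J' \<subseteq> J" "J' \<subseteq> I" "indep_vars N X I" for J' I
  proof (cases "J' = {}")
    case True then show ?thesis by (simp add: prob_space)
  next
    case False
    then have "space M \<inter> (\<Inter>j\<in>J'. E j) = (\<Inter>j\<in>J'. E j)" using E_sp that by fast
    moreover have "prob (\<Inter>j\<in>J'. E j) = (\<Prod>j\<in>J'. prob (E j))"
      using that J E False finite_subset[OF that(1)]
      by (intro indep_setsD[where I=I and F="\<lambda>j. {X j -` C \<inter> space M |C. C \<in> sets (N j)}"])
         (auto simp: indep_vars_def2)
    ultimately show ?thesis by simp
  qed
  have mem: "space M \<inter> (\<Inter>j\<in>J'. E j) \<in> sets G"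
    if "J' \<subseteq> J" "space G = space M" and X_meas: "\<And>j. j \<in> J' \<Longrightarrow> X j \<in> measurable G (N j)" for J' G
  proof -
    have "E j \<in> sets G" if j: "j \<in> J'" for j
    proof -
      obtain C where "C \<in> sets (N j)" "E j = X j -` C \<inter> space M"
        using E \<open>J' \<subseteq> J\<close> j by blast
      then show ?thesis using measurable_sets[OF X_meas[OF j]] j \<open>space G = space M\<close> by simp
    qed
    moreover have "finite J'" using J that finite_subset by blast
    ultimately have "space G \<inter> (\<Inter>j\<in>J'. E j) \<in> sets G"
      by (cases "J' = {}") (auto intro: sets.Int)
    then show ?thesis using that by simp
  qed
  let ?J1 = "J \<inter> I1" and ?J2 = "J \<inter> I2"
  have "(\<Inter>j\<in>J. E j) = (space M \<inter> (\<Inter>j\<in>?J1. E j)) \<inter> (space M \<inter> (\<Inter>j\<in>?J2. E j))"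
    using J E_sp by blast
  also have "prob \<dots> = prob (space M \<inter> (\<Inter>j\<in>?J1. E j)) * prob (space M \<inter> (\<Inter>j\<in>?J2. E j))"
    using ind sp A B by (intro indep_setD[OF ind] mem) auto
  also have "\<dots> = (\<Prod>j\<in>?J1. prob (E j)) * (\<Prod>j\<in>?J2. prob (E j))"
    using prod[of ?J1 I1] prod[of ?J2 I2] X1 X2 by simp
  also have "\<dots> = (\<Prod>j\<in>?J1 \<union> ?J2. prob (E j))"
    using J disj by (intro prod.union_disjoint[symmetric]) auto
  also have "?J1 \<union> ?J2 = J" using J by auto
  finally show "prob (\<Inter>j\<in>J. E j) = (\<Prod>j\<in>J. prob (E j))" .
qed

text \<open>\<open>indep_var\<close> is by definition independence of a family indexed by the
  Booleans, so the pair is a reindexing along \<open>case_bool i j\<close>.\<close>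

lemma indep_vars_imp_indep_var:
  assumes "indep_vars (\<lambda>_. N) X I" "i \<in> I" "j \<in> I" "i \<noteq> j"
  shows "indep_var N (X i) N (X j)"
proof -
  have "indep_vars (\<lambda>_. N) (\<lambda>b. X (case_bool i j b)) UNIV"
    by (rule indep_vars_reindex[where N="\<lambda>_. N" and h="case_bool i j"], rule indep_vars_subset[OF assms(1)])
      (use assms in \<open>auto simp: inj_on_def split: bool.splits\<close>)
  then show ?thesis
    unfolding indep_var_def
    by (rule indep_vars_cong[THEN iffD1, rotated -1]) (auto split: bool.splits)
qed

lemma indep_sets_imp_indep_set:
  assumes "indep_sets F I" "i \<in> I" "j \<in> I" "i \<noteq> j"
  shows "indep_set (F i) (F j)"
proof (rule indep_setI)
  fix a b assume "a \<in> F i" "b \<in> F j"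
  then show "prob (a \<inter> b) = prob a * prob b"
    using indep_setsD[OF assms(1), of "{i, j}" "\<lambda>x. if x = i then a else b"] assms by (auto simp: Int_commute)
qed (use assms in \<open>auto simp: indep_sets_def\<close>)

text \<open>Independence of intersection-stable families passes to the algebras generated by
  disjoint blocks of indices, here \<open>{0, 1}\<close> and \<open>{2}\<close>. This makes symbols
  and noise jointly independent of the channels.\<close>

lemma indep_set_sigma_Un:
  assumes ind: "indep_sets (nth [sets A, sets B, sets C]) {..<3}"
    and sp: "space A = space M" "space B = space M" "space C = space M"
  shows "indep_set (sets (sigma (space M) (sets A \<union> sets B))) (sets C)"
proof -
  let ?E = "nth [sets A, sets B, sets C]"
  have stable: "Int_stable (?E i)" if "i < 3" for i
    using that by (auto simp: less_Suc_eq numeral_3_eq_3 sets.Int_stable)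
  have "indep_sets (\<lambda>b. sigma_sets (space M) (\<Union>i\<in>case_bool {0, 1} {2} b. ?E i)) UNIV"
    by (rule indep_sets_collect_sigma)
      (auto simp: disjoint_family_on_def UNIV_bool sets.Int_stable split: bool.splits
        intro!: stable indep_sets_mono_index[OF _ ind])
  moreover have "sigma_sets (space M) (\<Union>i\<in>case_bool {0, 1} {2} b. ?E i)
      = case_bool (sets (sigma (space M) (sets A \<union> sets B))) (sets C) b" for b
    using sets.sets_into_space[of _ A] sets.sets_into_space[of _ B] sets.sigma_sets_eq[of C] sp
    by (cases b) (auto simp: sets_measure_of[of "sets A \<union> sets B" "space M"] subset_iff Pow_def)
  ultimately show ?thesis
    by (simp add: indep_set_def)
qed

subsection \<open>The weak law of large numbers in mean\<close>

text \<open>Nonnegativity of the variance; it turns a second-moment bound into a bound in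
  mean.\<close>

lemma expectation_le_sqrt_second_moment:
  fixes X :: "'a \<Rightarrow> real"
  assumes [measurable]: "integrable M X" and sq: "integrable M (\<lambda>\<omega>. (X \<omega>)\<^sup>2)"
  shows "expectation X \<le> sqrt (expectation (\<lambda>\<omega>. (X \<omega>)\<^sup>2))"
proof -
  have "(expectation X)\<^sup>2 \<le> expectation (\<lambda>\<omega>. (X \<omega>)\<^sup>2)"
    using variance_eq[OF assms] variance_positive[of X] by simp
  then show ?thesis
    by (rule real_le_rsqrt)
qed

text \<open>The product rule for independent families, applied to \<open>{n, m}\<close> with only
  the factor at \<open>m\<close> conjugated. The index type is general because the rule serves both
  for times and for pairs of source and time.\<close>

lemma expectation_mult_cnj_indep:
  fixes Y :: "'i \<Rightarrow> 'a \<Rightarrow> complex"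
  assumes ind: "indep_vars (\<lambda>_. borel) Y I" and "n \<in> I" "m \<in> I" and neq: "n \<noteq> m"
    and int: "integrable M (Y n)" "integrable M (Y m)"
  shows "integrable M (\<lambda>\<omega>. Y n \<omega> * cnj (Y m \<omega>))"
    and "expectation (\<lambda>\<omega>. Y n \<omega> * cnj (Y m \<omega>)) = expectation (Y n) * cnj (expectation (Y m))"
proof -
  let ?f = "\<lambda>i. if i = m then cnj else (\<lambda>z. z)"
  have iv: "indep_vars (\<lambda>_. borel) (\<lambda>i \<omega>. ?f i (Y i \<omega>)) {n, m}"
    by (rule indep_vars_compose2[OF indep_vars_subset[OF ind]]) (use assms in auto)
  have int_f: "integrable M (\<lambda>\<omega>. ?f i (Y i \<omega>))" if "i \<in> {n, m}" for i
    using that int by auto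
  have prod: "(\<Prod>i\<in>{n, m}. ?f i (Y i \<omega>)) = Y n \<omega> * cnj (Y m \<omega>)" for \<omega>
    using neq by simp
  show "integrable M (\<lambda>\<omega>. Y n \<omega> * cnj (Y m \<omega>))"
    using indep_vars_integrable[OF _ iv int_f] unfolding prod by simp
  show "expectation (\<lambda>\<omega>. Y n \<omega> * cnj (Y m \<omega>)) = expectation (Y n) * cnj (expectation (Y m))"
    using indep_vars_lebesgue_integral[OF _ iv int_f] neq unfolding prod by simp
qed

text \<open>In the expanded double sum the off-diagonal terms vanish by independence and zero means.
  The \<open>card I\<close> diagonal terms are at most \<open>C\<^sup>2\<close> each.\<close>

lemma second_moment_sum_bounded:
  fixes Y :: "nat \<Rightarrow> 'a \<Rightarrow> complex"
  assumes ind: "indep_vars (\<lambda>_. borel) Y I" and fin: "finite I"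
    and bnd: "\<And>n \<omega>. n \<in> I \<Longrightarrow> cmod (Y n \<omega>) \<le> C"
    and mean: "\<And>n. n \<in> I \<Longrightarrow> expectation (Y n) = 0"
  shows "expectation (\<lambda>\<omega>. (cmod (\<Sum>n\<in>I. Y n \<omega>))\<^sup>2) \<le> real (card I) * C\<^sup>2"
proof -
  have rv: "Y n \<in> borel_measurable M" if "n \<in> I" for n
    using ind that by (auto simp: indep_vars_def)
  have int: "integrable M (Y n)" if "n \<in> I" for n
    by (rule integrable_const_bound[where B=C]) (auto simp: rv bnd that)
  have prod: "integrable M (\<lambda>\<omega>. Y n \<omega> * cnj (Y m \<omega>))
      \<and> expectation (\<lambda>\<omega>. Y n \<omega> * cnj (Y m \<omega>)) = (if n = m then expectation (\<lambda>\<omega>. of_real ((cmod (Y n \<omega>))\<^sup>2)) else 0)"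
    if nm: "n \<in> I" "m \<in> I" for n m
  proof (cases "n = m")
    case True
    have "integrable M (\<lambda>\<omega>. complex_of_real ((cmod (Y m \<omega>))\<^sup>2))"
      by (rule integrable_const_bound[where B="C\<^sup>2"])
        (use rv[OF nm(2)] in \<open>auto simp: bnd nm norm_power intro!: power_mono\<close>)
    then show ?thesis
      using True by (simp add: complex_norm_square del: of_real_power)
  next
    case False
    show ?thesis
      using False expectation_mult_cnj_indep[OF ind nm False int[OF nm(1)] int[OF nm(2)]] nm by (auto simp: int mean)
  qed
  have sq: "complex_of_real ((cmod (\<Sum>n\<in>I. Y n \<omega>))\<^sup>2) = (\<Sum>n\<in>I. \<Sum>m\<in>I. Y n \<omega> * cnj (Y m \<omega>))" for \<omega>
    by (subst complex_norm_square) (simp add: sum_product)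
  have "complex_of_real (expectation (\<lambda>\<omega>. (cmod (\<Sum>n\<in>I. Y n \<omega>))\<^sup>2))
      = expectation (\<lambda>\<omega>. \<Sum>n\<in>I. \<Sum>m\<in>I. Y n \<omega> * cnj (Y m \<omega>))"
    by (simp only: integral_complex_of_real[symmetric] sq)
  also have "\<dots> = (\<Sum>n\<in>I. \<Sum>m\<in>I. expectation (\<lambda>\<omega>. Y n \<omega> * cnj (Y m \<omega>)))"
    using prod by (subst Bochner_Integration.integral_sum)
      (auto intro!: sum.cong Bochner_Integration.integral_sum)
  also have "\<dots> = (\<Sum>n\<in>I. \<Sum>m\<in>I. if n = m then expectation (\<lambda>\<omega>. of_real ((cmod (Y n \<omega>))\<^sup>2)) else 0)"
    using prod by (auto intro!: sum.cong)
  also have "\<dots> = (\<Sum>n\<in>I. complex_of_real (expectation (\<lambda>\<omega>. (cmod (Y n \<omega>))\<^sup>2)))"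
    using fin by (auto intro!: sum.cong simp del: of_real_power)
  finally have "expectation (\<lambda>\<omega>. (cmod (\<Sum>n\<in>I. Y n \<omega>))\<^sup>2) = (\<Sum>n\<in>I. expectation (\<lambda>\<omega>. (cmod (Y n \<omega>))\<^sup>2))"
    by (simp only: of_real_sum[symmetric] of_real_eq_iff)
  also have "\<dots> \<le> (\<Sum>n\<in>I. C\<^sup>2)"
  proof (rule sum_mono)
    fix n assume n: "n \<in> I"
    have "expectation (\<lambda>\<omega>. (cmod (Y n \<omega>))\<^sup>2) \<le> expectation (\<lambda>_. C\<^sup>2)"
    proof (rule integral_mono)
      show "integrable M (\<lambda>\<omega>. (cmod (Y n \<omega>))\<^sup>2)"
        by (rule integrable_const_bound[where B="C\<^sup>2"]) (use rv[OF n] in \<open>auto simp: bnd n intro!: power_mono\<close>)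
    qed (auto simp: bnd n intro!: power_mono)
    then show "expectation (\<lambda>\<omega>. (cmod (Y n \<omega>))\<^sup>2) \<le> C\<^sup>2"
      by (simp add: prob_space)
  qed
  finally show ?thesis
    by simp
qed

text \<open>Dominated convergence with majorant \<open>cmod (X \<omega>)\<close>: at each point the
  tail is 0 once the level exceeds the modulus.\<close>

lemma expectation_truncation_small:
  fixes X :: "'a \<Rightarrow> complex"
  assumes X: "integrable M X" and "\<delta> > 0"
  obtains C where "C \<ge> 0" "expectation (\<lambda>\<omega>. if cmod (X \<omega>) \<le> C then 0 else cmod (X \<omega>)) < \<delta>"
proof -
  have [measurable]: "X \<in> borel_measurable M" using X by auto
  have "(\<lambda>j. expectation (\<lambda>\<omega>. if cmod (X \<omega>) \<le> real j then 0 else cmod (X \<omega>))) \<longlonglongrightarrow> expectation (\<lambda>_. 0)"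
  proof (rule integral_dominated_convergence)
    show "integrable M (\<lambda>\<omega>. cmod (X \<omega>))" using X by auto
    show "AE \<omega> in M. (\<lambda>j. if cmod (X \<omega>) \<le> real j then 0 else cmod (X \<omega>)) \<longlonglongrightarrow> 0"
    proof (rule AE_I2)
      fix \<omega>
      obtain k where k: "cmod (X \<omega>) \<le> real k" using real_arch_simple by blast
      have "\<forall>\<^sub>F j in sequentially. (if cmod (X \<omega>) \<le> real j then 0 else cmod (X \<omega>)) = 0"
        using eventually_ge_at_top[of k] by eventually_elim (use k in auto)
      then show "(\<lambda>j. if cmod (X \<omega>) \<le> real j then 0 else cmod (X \<omega>)) \<longlonglongrightarrow> 0"
        by (rule tendsto_eventually)
    qed
  qed auto
  then have "\<forall>\<^sub>F j in sequentially. expectation (\<lambda>\<omega>. if cmod (X \<omega>) \<le> real j then 0 else cmod (X \<omega>)) < \<delta>"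
    using \<open>\<delta> > 0\<close> by (intro order_tendstoD(2)) auto
  then obtain j where "expectation (\<lambda>\<omega>. if cmod (X \<omega>) \<le> real j then 0 else cmod (X \<omega>)) < \<delta>"
    by (auto simp: eventually_sequentially)
  then show ?thesis by (intro that[of "real j"]) auto
qed

text \<open>Truncation at level \<open>C\<close> leaves a bounded part, whose centred average has
  mean modulus of order \<open>1 / sqrt N\<close>, and a tail that is small in mean uniformly in
  \<open>n\<close> because the laws agree.\<close>

lemma weak_law_L1:
  fixes X :: "nat \<Rightarrow> 'a \<Rightarrow> complex"
  assumes ind: "indep_vars (\<lambda>_. borel) X {1..}"
    and ident: "\<And>n. n \<ge> 1 \<Longrightarrow> distr M borel (X n) = distr M borel (X 1)"
    and int1: "integrable M (X 1)"
  shows "(\<lambda>N. expectation (\<lambda>\<omega>. cmod ((\<Sum>n=1..N. X n \<omega>) / of_nat N - expectation (X 1)))) \<longlonglongrightarrow> 0"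
    (is "?E \<longlonglongrightarrow> 0")
proof -
  have rv: "X n \<in> borel_measurable M" if "n \<ge> 1" for n
    using ind that by (auto simp: indep_vars_def)
  \<comment> \<open>Integrability is a property of the law, so it passes from \<open>X 1\<close> to
    every \<open>X n\<close>.\<close>
  have int: "integrable M (X n)" if "n \<ge> 1" for n
  proof -
    have "integrable (distr M borel (X n)) (\<lambda>x. x)"
      unfolding ident[OF that] using int1 rv[of 1] by (subst integrable_distr_eq) auto
    then show ?thesis
      using rv[OF that] by (subst (asm) integrable_distr_eq) auto
  qed
  have transfer: "expectation (\<lambda>\<omega>. f (X n \<omega>)) = expectation (\<lambda>\<omega>. f (X 1 \<omega>))"
    if "n \<ge> 1" "f \<in> borel_measurable borel" for n and f :: "complex \<Rightarrow> 'b :: {banach, second_countable_topology}"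
  proof -
    have "expectation (\<lambda>\<omega>. f (X n \<omega>)) = integral\<^sup>L (distr M borel (X n)) f"
      by (rule integral_distr[symmetric]) (use rv that in auto)
    also have "\<dots> = expectation (\<lambda>\<omega>. f (X 1 \<omega>))"
      unfolding ident[OF that(1)] by (rule integral_distr) (use rv[of 1] that in auto)
    finally show ?thesis .
  qed
  \<comment> \<open>The factor 2 in \<open>2 * C\<close> comes from centring the truncated
    variables. The tail costs \<delta> twice: in the average and in the mean.\<close>
  have bound: "?E N \<le> 2 * C / sqrt (real N) + 2 * \<delta>"
    if C: "C \<ge> 0" and tail: "expectation (\<lambda>\<omega>. if cmod (X 1 \<omega>) \<le> C then 0 else cmod (X 1 \<omega>)) < \<delta>"
      and N: "N > 0" for C \<delta> N
  proof -
    define u where "u z = (if cmod z \<le> C then z else 0)" for z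
    define v where "v z = (if cmod z \<le> C then 0 else z)" for z
    have [measurable]: "u \<in> borel_measurable borel" "v \<in> borel_measurable borel"
      unfolding u_def v_def by measurable
    have uv: "z = u z + v z" for z by (auto simp: u_def v_def)
    have u_bnd: "cmod (u z) \<le> C" for z using C by (auto simp: u_def)
    have [measurable]: "X 1 \<in> borel_measurable M" using rv by auto
    have int_u: "integrable M (\<lambda>\<omega>. u (X n \<omega>))" if "n \<ge> 1" for n
      by (rule integrable_const_bound[where B=C]) (use rv[OF that] in \<open>auto simp: u_bnd\<close>)
    have int_v: "integrable M (\<lambda>\<omega>. v (X n \<omega>))" if "n \<ge> 1" for n
      by (rule Bochner_Integration.integrable_bound[OF int[OF that]])
         (use rv[OF that] in \<open>auto simp: v_def\<close>)
    define a where "a = expectation (\<lambda>\<omega>. u (X 1 \<omega>))"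
    \<comment> \<open>Centring uses the mean \<open>a\<close> of the truncated variable. Its
      difference \<open>b\<close> from the true mean is the expectation of the tail part, at most
      \<delta> in modulus.\<close>
    define Y where "Y n \<omega> = u (X n \<omega>) - a" for n \<omega>
    have a_bnd: "cmod a \<le> C"
    proof -
      have "cmod a \<le> expectation (\<lambda>\<omega>. cmod (u (X 1 \<omega>)))"
        unfolding a_def by (rule integral_norm_bound)
      also have "\<dots> \<le> expectation (\<lambda>_. C)"
        by (rule integral_mono) (use int_u[of 1] u_bnd in auto)
      finally show ?thesis by (simp add: prob_space)
    qed
    have Y_bnd: "cmod (Y n \<omega>) \<le> 2 * C" for n \<omega>
      using norm_triangle_ineq4[of "u (X n \<omega>)" a] u_bnd[of "X n \<omega>"] a_bnd unfolding Y_def by linarith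
    have Y_ind: "indep_vars (\<lambda>_. borel) Y {1..N}"
      unfolding Y_def by (rule indep_vars_compose2[OF indep_vars_subset[OF ind]]) auto
    have Y_rv: "Y n \<in> borel_measurable M" if "n \<ge> 1" for n
      unfolding Y_def using rv[OF that] by measurable
    have Y_mean: "expectation (Y n) = 0" if "n \<ge> 1" for n
      unfolding Y_def using int_u[OF that] transfer[OF that, of u] by (simp add: a_def prob_space)
    define S where "S \<omega> = cmod (\<Sum>n=1..N. Y n \<omega>)" for \<omega>
    have S_rv [measurable]: "S \<in> borel_measurable M"
      unfolding S_def by (rule measurable_compose[OF borel_measurable_sum borel_measurable_norm]) (auto intro: Y_rv)
    \<comment> \<open>This bound of order \<open>N\<close> serves only for integrability; the rate
      comes from the second moment in \<open>S_E\<close>.\<close>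
    have S_bnd: "S \<omega> \<le> real N * (2 * C)" for \<omega>
      unfolding S_def using sum_norm_bound[of "{1..N}" "\<lambda>n. Y n \<omega>" "2 * C"] Y_bnd by auto
    have S_nn: "0 \<le> S \<omega>" for \<omega> by (simp add: S_def)
    have S_int: "integrable M S"
      by (rule integrable_const_bound[where B="real N * (2 * C)"]) (auto simp: S_bnd S_nn)
    have S2_int: "integrable M (\<lambda>\<omega>. (S \<omega>)\<^sup>2)"
      by (rule integrable_const_bound[where B="(real N * (2 * C))\<^sup>2"]) (auto intro!: power_mono S_bnd S_nn)
    have S_E: "expectation S \<le> sqrt (real N) * (2 * C)"
    proof -
      have "expectation S \<le> sqrt (expectation (\<lambda>\<omega>. (S \<omega>)\<^sup>2))"
        by (rule expectation_le_sqrt_second_moment[OF S_int S2_int])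
      also have "\<dots> \<le> sqrt (real (card {1..N}) * (2 * C)\<^sup>2)"
        unfolding S_def
        by (intro real_sqrt_le_mono second_moment_sum_bounded Y_ind Y_bnd Y_mean) auto
      also have "\<dots> = sqrt (real N) * (2 * C)" using C by (simp add: real_sqrt_mult)
      finally show ?thesis .
    qed
    define V where "V n \<omega> = cmod (v (X n \<omega>))" for n \<omega>
    have V_int: "integrable M (V n)" if "n \<ge> 1" for n
      unfolding V_def using int_v[OF that] by auto
    have V_E: "expectation (V n) < \<delta>" if "n \<ge> 1" for n
    proof -
      have "expectation (V n) = expectation (\<lambda>\<omega>. cmod (v (X 1 \<omega>)))"
        unfolding V_def by (rule transfer[OF that]) measurable
      also have "\<dots> = expectation (\<lambda>\<omega>. if cmod (X 1 \<omega>) \<le> C then 0 else cmod (X 1 \<omega>))"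
        by (rule Bochner_Integration.integral_cong) (auto simp: v_def)
      finally show ?thesis using tail by simp
    qed
    define b where "b = expectation (\<lambda>\<omega>. v (X 1 \<omega>))"
    have b_bnd: "cmod b \<le> \<delta>"
      unfolding b_def by (rule order_trans[OF integral_norm_bound]) (use V_E[of 1] in \<open>simp add: V_def[abs_def]\<close>)
    have mean: "expectation (X 1) = a + b"
    proof -
      have "expectation (X 1) = expectation (\<lambda>\<omega>. u (X 1 \<omega>) + v (X 1 \<omega>))"
        by (simp flip: uv)
      also have "\<dots> = a + b"
        unfolding a_def b_def using int_u[of 1] int_v[of 1] by simp
      finally show ?thesis .
    qed
    have pointwise: "cmod ((\<Sum>n=1..N. X n \<omega>) / of_nat N - expectation (X 1))
        \<le> S \<omega> / real N + (\<Sum>n=1..N. V n \<omega>) / real N + \<delta>" for \<omega>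
    proof -
      have "(\<Sum>n=1..N. X n \<omega>) = (\<Sum>n=1..N. Y n \<omega> + v (X n \<omega>) + a)"
        by (rule sum.cong) (use uv in \<open>auto simp: Y_def\<close>)
      also have "\<dots> = (\<Sum>n=1..N. Y n \<omega>) + (\<Sum>n=1..N. v (X n \<omega>)) + of_nat N * a"
        by (simp add: sum.distrib)
      finally have "(\<Sum>n=1..N. X n \<omega>) / of_nat N - expectation (X 1)
          = (\<Sum>n=1..N. Y n \<omega>) / of_nat N + (\<Sum>n=1..N. v (X n \<omega>)) / of_nat N - b"
        using N mean by (simp add: add_divide_distrib)
      also have "cmod \<dots> \<le> cmod ((\<Sum>n=1..N. Y n \<omega>) / of_nat N) + cmod ((\<Sum>n=1..N. v (X n \<omega>)) / of_nat N) + cmod b"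
        by (intro order_trans[OF norm_triangle_ineq4] add_right_mono norm_triangle_ineq)
      also have "\<dots> \<le> S \<omega> / real N + (\<Sum>n=1..N. V n \<omega>) / real N + \<delta>"
        by (intro add_mono) (auto simp: S_def V_def norm_divide b_bnd intro!: divide_right_mono norm_sum)
      finally show ?thesis .
    qed
    have "?E N \<le> expectation (\<lambda>\<omega>. S \<omega> / real N + (\<Sum>n=1..N. V n \<omega>) / real N + \<delta>)"
      by (intro integral_mono pointwise integrable_norm Bochner_Integration.integrable_add
            Bochner_Integration.integrable_diff integrable_divide_zero impI
            Bochner_Integration.integrable_sum S_int V_int int integrable_const) auto
    also have "\<dots> = expectation S / real N + (\<Sum>n=1..N. expectation (V n)) / real N + \<delta>"
    proof -
      have "integrable M (\<lambda>\<omega>. \<Sum>n=1..N. V n \<omega>)"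
        by (rule Bochner_Integration.integrable_sum) (simp add: V_int)
      moreover have "expectation (\<lambda>\<omega>. \<Sum>n=1..N. V n \<omega>) = (\<Sum>n=1..N. expectation (V n))"
        by (rule Bochner_Integration.integral_sum) (simp add: V_int)
      ultimately show ?thesis
        using S_int by (simp add: prob_space)
    qed
    also have "\<dots> \<le> sqrt (real N) * (2 * C) / real N + (\<Sum>n=1..N. \<delta>) / real N + \<delta>"
      by (intro add_mono divide_right_mono S_E sum_mono less_imp_le[OF V_E]) auto
    also have "\<dots> = 2 * C / sqrt (real N) + 2 * \<delta>"
      using N by (simp add: field_simps flip: power2_eq_square)
    finally show ?thesis .
  qed
  show ?thesis
  proof (rule order_tendstoI)
    fix e :: real assume "e < 0"
    then have "e < ?E N" for N
      by (rule order.strict_trans2) (rule Bochner_Integration.integral_nonneg, simp)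
    then show "\<forall>\<^sub>F N in sequentially. e < ?E N" by (rule always_eventually[OF allI])
  next
    fix e :: real assume e: "e > 0"
    \<comment> \<open>With \<delta> equal to \<open>e / 4\<close> the tail contributes
      \<open>e / 2\<close>; for this fixed \<open>C\<close>, large \<open>N\<close> pushes the other
      term below \<open>e / 2\<close>.\<close>
    obtain C where C: "C \<ge> 0" "expectation (\<lambda>\<omega>. if cmod (X 1 \<omega>) \<le> C then 0 else cmod (X 1 \<omega>)) < e / 4"
      using expectation_truncation_small[OF int1, of "e / 4"] e by auto
    have "(\<lambda>N. 2 * C / sqrt (real N)) \<longlonglongrightarrow> 0"
      by (intro tendsto_divide_0[OF tendsto_const] filterlim_at_top_imp_at_infinity
            filterlim_compose[OF sqrt_at_top filterlim_real_sequentially])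
    then have "\<forall>\<^sub>F N in sequentially. 2 * C / sqrt (real N) < e / 2"
      using e by (intro order_tendstoD(2)) auto
    then show "\<forall>\<^sub>F N in sequentially. ?E N < e"
      using eventually_gt_at_top[of 0]
    proof eventually_elim
      case (elim N)
      then show ?case using bound[OF C, of N] by simp
    qed
  qed
qed

lemma integrable_of_square:
  fixes f :: "'a \<Rightarrow> complex"
  assumes [measurable]: "f \<in> borel_measurable M" and sq: "integrable M (\<lambda>\<omega>. (cmod (f \<omega>))\<^sup>2)"
  shows "integrable M f"
proof -
  have "integrable M (\<lambda>\<omega>. cmod (f \<omega>))"
    by (rule square_integrable_imp_integrable) (use sq in auto)
  then show ?thesis
    by (simp add: integrable_norm_iff)
qed

text \<open>For fixed \<open>p\<close> and \<open>q\<close> the products at different times depend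
  on disjoint sets of variables and have equal laws, so the weak law in mean applies. Their common
  mean is \<open>P p\<close> on the diagonal and 0 off it.\<close>

lemma weak_law_cross_moments:
  fixes Z :: "'p \<Rightarrow> nat \<Rightarrow> 'a \<Rightarrow> complex"
  assumes ind: "indep_vars (\<lambda>_. borel) (\<lambda>(p, n). Z p n) (UNIV \<times> {1..})"
    and ident: "\<And>p n. n \<ge> 1 \<Longrightarrow> distr M borel (Z p n) = distr M borel (Z p 1)"
    and sq: "\<And>p n. n \<ge> 1 \<Longrightarrow> integrable M (\<lambda>\<omega>. (cmod (Z p n \<omega>))\<^sup>2)"
    and uncor: "\<And>p q. p \<noteq> q \<Longrightarrow> expectation (Z p 1) * cnj (expectation (Z q 1)) = 0"
    and pow: "\<And>p. expectation (\<lambda>\<omega>. (cmod (Z p 1 \<omega>))\<^sup>2) = P p"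
  shows "n \<ge> 1 \<Longrightarrow> integrable M (\<lambda>\<omega>. Z p n \<omega> * cnj (Z q n \<omega>))"
    and "(\<lambda>N. expectation (\<lambda>\<omega>. cmod ((\<Sum>n=1..N. Z p n \<omega> * cnj (Z q n \<omega>)) / of_nat N
           - (if p = q then of_real (P p) else 0)))) \<longlonglongrightarrow> 0"
proof -
  have rv: "Z p n \<in> borel_measurable M" if "n \<ge> 1" for p n
    using ind that by (auto simp: indep_vars_def)
  have int: "integrable M (Z p n)" if "n \<ge> 1" for p n
    using integrable_of_square[OF rv sq] that by blast
  note cross = expectation_mult_cnj_indep[OF ind, of "(p, n)" "(q, n)" for n, simplified]
  show int_prod: "integrable M (\<lambda>\<omega>. Z p n \<omega> * cnj (Z q n \<omega>))" if n: "n \<ge> 1" for n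
  proof (cases "p = q")
    case True
    have "integrable M (\<lambda>\<omega>. complex_of_real ((cmod (Z p n \<omega>))\<^sup>2))"
      using sq[OF n] by (rule integrable_of_real)
    then show ?thesis using True by (simp add: complex_norm_square del: of_real_power)
  next
    case False
    then show ?thesis using cross(1)[of n] n int[OF n] by auto
  qed
  have mean: "expectation (\<lambda>\<omega>. Z p 1 \<omega> * cnj (Z q 1 \<omega>)) = (if p = q then of_real (P p) else 0)"
  proof (cases "p = q")
    case True
    have "complex_of_real (P p) = expectation (\<lambda>\<omega>. complex_of_real ((cmod (Z p 1 \<omega>))\<^sup>2))"
      unfolding pow[symmetric] by (rule integral_complex_of_real[symmetric])
    then show ?thesis using True by (simp add: complex_norm_square del: of_real_power)
  next
    case False
    then show ?thesis using cross(2)[of 1] int[of 1] uncor[OF False] by auto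
  qed
  have "(\<lambda>N. expectation (\<lambda>\<omega>. cmod ((\<Sum>n=1..N. Z p n \<omega> * cnj (Z q n \<omega>)) / of_nat N
           - expectation (\<lambda>\<omega>. Z p 1 \<omega> * cnj (Z q 1 \<omega>))))) \<longlonglongrightarrow> 0"
  proof (rule weak_law_L1)
    \<comment> \<open>The blocks \<open>?K n\<close> are disjoint for different \<open>n\<close>.
      For \<open>p = q\<close> they collapse to singletons, so both cases are covered at
      once.\<close>
    let ?K = "\<lambda>n. {(p, n), (q, n)}"
    have "indep_vars (\<lambda>n. PiM (?K n) (\<lambda>_. borel)) (\<lambda>n \<omega>. restrict (\<lambda>i. (\<lambda>(p, n). Z p n) i \<omega>) (?K n)) {1..}"
      by (rule indep_vars_restrict[OF ind]) (auto simp: disjoint_family_on_def)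
    from indep_vars_compose2[OF this, of "\<lambda>n x. x (p, n) * cnj (x (q, n))" "\<lambda>_. borel"]
    show "indep_vars (\<lambda>_. borel) (\<lambda>n \<omega>. Z p n \<omega> * cnj (Z q n \<omega>)) {1..}"
      by simp
  next
    \<comment> \<open>For \<open>p = q\<close> the law of the product is an image of one marginal.
      For distinct indices independence makes the joint law a product measure, again determined by
      the marginals, which do not depend on \<open>n\<close>.\<close>
    fix n :: nat assume n: "n \<ge> 1"
    show "distr M borel (\<lambda>\<omega>. Z p n \<omega> * cnj (Z q n \<omega>)) = distr M borel (\<lambda>\<omega>. Z p 1 \<omega> * cnj (Z q 1 \<omega>))"
    proof (cases "p = q")
      case True
      have "distr M borel (\<lambda>\<omega>. Z p n \<omega> * cnj (Z p n \<omega>)) = distr (distr M borel (Z p n)) borel (\<lambda>z. z * cnj z)"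
        if "n \<ge> 1" for n
        using rv[OF that] by (subst distr_distr) (auto simp: comp_def)
      from this[OF n] this[of 1] show ?thesis using ident[OF n, of p] True by simp
    next
      case False
      have "distr M borel (\<lambda>\<omega>. Z p n \<omega> * cnj (Z q n \<omega>))
          = distr (distr M borel (Z p n) \<Otimes>\<^sub>M distr M borel (Z q n)) borel (\<lambda>(z, y). z * cnj y)"
        if n: "n \<ge> 1" for n
      proof -
        have "indep_var borel (Z p n) borel (Z q n)"
          using indep_vars_imp_indep_var[OF ind, of "(p, n)" "(q, n)"] False n by auto
        then have "distr M borel (Z p n) \<Otimes>\<^sub>M distr M borel (Z q n) = distr M (borel \<Otimes>\<^sub>M borel) (\<lambda>\<omega>. (Z p n \<omega>, Z q n \<omega>))"
          by (simp add: indep_var_distribution_eq)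
        then show ?thesis
          using rv[OF n] by (simp add: distr_distr comp_def)
      qed
      from this[OF n] this[of 1] show ?thesis using ident[OF n, of p] ident[OF n, of q] by simp
    qed
  qed (rule int_prod, simp)
  then show "(\<lambda>N. expectation (\<lambda>\<omega>. cmod ((\<Sum>n=1..N. Z p n \<omega> * cnj (Z q n \<omega>)) / of_nat N
           - (if p = q then of_real (P p) else 0)))) \<longlonglongrightarrow> 0"
    by (simp only: mean)
qed

subsection \<open>Conditional convergence in probability\<close>

text \<open>The constant \<open>prob B\<close> has the characterizing property of the conditional
  expectation: over each \<open>A\<close> in \<open>F\<close> both integrals equal
  \<open>prob (A \<inter> B)\<close>.\<close>

lemma real_cond_exp_indicator_indep:
  assumes F: "subalgebra M F" and B: "B \<in> events"
    and ind: "\<And>A. A \<in> sets F \<Longrightarrow> prob (A \<inter> B) = prob A * prob B"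
  shows "AE \<omega> in M. real_cond_exp M F (indicator B) \<omega> = prob B"
proof -
  interpret finite_measure_subalgebra M F by standard (rule F)
  show ?thesis
  proof (rule real_cond_exp_charact)
    fix A assume A: "A \<in> sets F"
    then have "A \<in> events" using F by (auto simp: subalgebra_def)
    then show "(\<integral>x\<in>A. indicator B x \<partial>M) = (\<integral>x\<in>A. prob B \<partial>M)"
      using ind[OF A] B
      by (simp add: set_lebesgue_integral_def indicator_inter_arith[symmetric])
  qed (use B in \<open>auto simp: emeasure_eq_measure\<close>)
qed

text \<open>On \<open>{W \<le> m}\<close> the deviation event lies in \<open>{S t > \<epsilon> / m}\<close>, whose conditional probability
  is its probability.\<close>

lemma cond_tendsto_in_prob_product_bound:
  assumes F: "subalgebra M F"
    and X: "\<And>t. X t \<in> borel_measurable M" and Y: "Y \<in> borel_measurable M"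
    and W: "W \<in> borel_measurable F"
    and bound: "\<And>t \<omega>. t \<ge> t0 \<Longrightarrow> \<omega> \<in> space M \<Longrightarrow> \<bar>X t \<omega> - Y \<omega>\<bar> \<le> W \<omega> * S t \<omega>"
    and S_nn: "\<And>t \<omega>. S t \<omega> \<ge> 0"
    and S_int: "\<And>t. integrable M (S t)"
    and S_lim: "(\<lambda>t. expectation (S t)) \<longlonglongrightarrow> 0"
    and S_G: "\<And>t. S t \<in> borel_measurable G" and spG: "space G = space M"
    and GF: "indep_set (sets G) (sets F)"
  shows "cond_tendsto_in_prob M F X Y"
  unfolding cond_tendsto_in_prob_def
proof (intro conjI allI impI F X Y)
  fix \<epsilon> :: real assume \<epsilon>: "\<epsilon> > 0"
  interpret finite_measure_subalgebra M F by standard (rule F)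
  note [measurable] = X Y
  define E where "E t = {\<omega> \<in> space M. \<bar>X t \<omega> - Y \<omega>\<bar> > \<epsilon>}" for t
  \<comment> \<open>\<open>Suc m\<close> keeps the thresholds well defined at \<open>m = 0\<close>.
    The sets \<open>D m\<close> belong to \<open>F\<close> and exhaust the space, while
    \<open>B m t\<close> belongs to \<open>G\<close> and is therefore independent of
    \<open>F\<close>.\<close>
  define B where "B m t = {\<omega> \<in> space M. S t \<omega> \<ge> \<epsilon> / real (Suc m)}" for m t
  define D where "D m = {\<omega> \<in> space F. W \<omega> \<le> real (Suc m)}" for m
  have spF: "space F = space M" using F by (auto simp: subalgebra_def)
  have E_ev [measurable]: "E t \<in> events" for t unfolding E_def by measurable
  have B_G: "B m t \<in> sets G" for m t
    using S_G[of t] spG[symmetric] unfolding B_def by simp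
  have B_ev [measurable]: "B m t \<in> events" for m t
  proof -
    have "sets G \<subseteq> events"
      using GF unfolding indep_set_def indep_sets_def by (metis UNIV_I bool.case(1))
    then show ?thesis using B_G by blast
  qed
  have D_F: "D m \<in> sets F" for m using W unfolding D_def borel_measurable_iff_le by blast
  have D_ev [measurable]: "D m \<in> events" for m using D_F F by (auto simp: subalgebra_def)
  have B_lim: "(\<lambda>t. prob (B m t)) \<longlonglongrightarrow> 0" for m
  proof (rule tendsto_sandwich[where f="\<lambda>_. 0"])
    show "\<forall>\<^sub>F t in sequentially. prob (B m t) \<le> expectation (S t) / (\<epsilon> / real (Suc m))"
      unfolding B_def using \<epsilon>
      by (intro always_eventually allI integral_Markov_inequality_measure[where A="{}"] S_int) (auto simp: S_nn)
    show "(\<lambda>t. expectation (S t) / (\<epsilon> / real (Suc m))) \<longlonglongrightarrow> 0"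
      using tendsto_divide[OF S_lim tendsto_const[of "\<epsilon> / real (Suc m)"]] \<epsilon> by simp
  qed auto
  have B_cond: "AE \<omega> in M. real_cond_exp M F (indicator (B m t)) \<omega> = prob (B m t)" for m t
    using indep_setD[OF GF B_G] by (intro real_cond_exp_indicator_indep F B_ev) (simp add: Int_commute mult.commute)
  have DE_sub: "D m \<inter> E t \<subseteq> B m t" if "t \<ge> t0" for m t
  proof
    fix \<omega> assume \<omega>: "\<omega> \<in> D m \<inter> E t"
    then have "\<epsilon> < W \<omega> * S t \<omega>" using bound[OF that, of \<omega>] by (auto simp: E_def)
    also have "\<dots> \<le> real (Suc m) * S t \<omega>" using \<omega> S_nn by (intro mult_right_mono) (auto simp: D_def)
    finally show "\<omega> \<in> B m t" using \<omega> by (auto simp: B_def E_def field_simps)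
  qed
  \<comment> \<open>As \<open>D m\<close> is in \<open>F\<close>, its indicator factors out of the
    conditional expectation. Monotonicity applied to the intersection with \<open>D m\<close> thus
    bounds the conditional probability of \<open>E t\<close> on \<open>D m\<close>.\<close>
  have le: "AE \<omega> in M. t \<ge> t0 \<longrightarrow> \<omega> \<in> D m \<longrightarrow> real_cond_exp M F (indicator (E t)) \<omega> \<le> prob (B m t)" for m t
  proof (cases "t \<ge> t0")
    case True
    have "AE \<omega> in M. real_cond_exp M F (\<lambda>\<omega>. indicator (D m) \<omega> * indicator (E t) \<omega>) \<omega>
        = indicator (D m) \<omega> * real_cond_exp M F (indicator (E t)) \<omega>"
      using D_F by (intro real_cond_exp_mult)
        (auto simp: indicator_inter_arith[symmetric] emeasure_eq_measure)
    moreover have "AE \<omega> in M. real_cond_exp M F (\<lambda>\<omega>. indicator (D m) \<omega> * indicator (E t) \<omega>) \<omega>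
        \<le> real_cond_exp M F (indicator (B m t)) \<omega>"
      using DE_sub[OF True, of m]
      by (intro real_cond_exp_mono)
        (auto simp: indicator_inter_arith[symmetric] emeasure_eq_measure split: split_indicator)
    ultimately show ?thesis using B_cond[of m t] by eventually_elim auto
  qed auto
  have nonneg: "AE \<omega> in M. real_cond_exp M F (indicator (E t)) \<omega> \<ge> 0" for t
    by (rule real_cond_exp_pos) auto
  \<comment> \<open>There are only countably many pairs \<open>(m, t)\<close>, so one null set
    serves for all of them, and \<open>m\<close> may then be chosen depending on \<omega>.\<close>
  have "AE \<omega> in M. (\<forall>m t. t \<ge> t0 \<longrightarrow> \<omega> \<in> D m \<longrightarrow> real_cond_exp M F (indicator (E t)) \<omega> \<le> prob (B m t))
      \<and> (\<forall>t. real_cond_exp M F (indicator (E t)) \<omega> \<ge> 0)"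
    using le nonneg by (auto simp: AE_all_countable)
  then show "AE \<omega> in M. (\<lambda>t. real_cond_exp M F (indicator {\<omega>' \<in> space M. \<bar>X t \<omega>' - Y \<omega>'\<bar> > \<epsilon>}) \<omega>) \<longlonglongrightarrow> 0"
    using AE_space
  proof eventually_elim
    case (elim \<omega>)
    obtain m where "W \<omega> \<le> real m" using real_arch_simple by blast
    then have D: "\<omega> \<in> D m" using elim spF by (auto simp: D_def)
    have "(\<lambda>t. real_cond_exp M F (indicator (E t)) \<omega>) \<longlonglongrightarrow> 0"
    proof (rule tendsto_sandwich[OF _ _ tendsto_const B_lim])
      show "\<forall>\<^sub>F t in sequentially. real_cond_exp M F (indicator (E t)) \<omega> \<le> prob (B m t)"
        using eventually_ge_at_top[of t0] by eventually_elim (use elim D in auto)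
    qed (use elim in auto)
    then show ?case by (simp add: E_def)
  qed
qed

text \<open>The counterpart for given gains, where the factor in front of \<open>S\<close> is a
  number and Markov's inequality suffices.\<close>

lemma tendsto_in_prob_product_bound:
  assumes X: "\<And>t. X t \<in> borel_measurable M" and Y: "Y \<in> borel_measurable M"
    and bound: "\<And>t \<omega>. t \<ge> t0 \<Longrightarrow> \<omega> \<in> space M \<Longrightarrow> \<bar>X t \<omega> - Y \<omega>\<bar> \<le> c * S t \<omega>"
    and S_nn: "\<And>t \<omega>. S t \<omega> \<ge> 0"
    and S_int: "\<And>t. integrable M (S t)"
    and S_lim: "(\<lambda>t. expectation (S t)) \<longlonglongrightarrow> 0"
  shows "tendsto_in_prob M X Y"
  unfolding tendsto_in_prob_def
proof (intro conjI allI impI X Y)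
  fix \<epsilon> :: real assume \<epsilon>: "\<epsilon> > 0"
  show "(\<lambda>t. prob {\<omega> \<in> space M. \<bar>X t \<omega> - Y \<omega>\<bar> > \<epsilon>}) \<longlonglongrightarrow> 0"
  proof (rule tendsto_sandwich[where f="\<lambda>_. 0"])
    \<comment> \<open>The absolute value of \<open>c\<close> appears since the sign of
      \<open>c\<close> is left open.\<close>
    show "\<forall>\<^sub>F t in sequentially. prob {\<omega> \<in> space M. \<bar>X t \<omega> - Y \<omega>\<bar> > \<epsilon>} \<le> \<bar>c\<bar> * expectation (S t) / \<epsilon>"
      using eventually_ge_at_top[of t0]
    proof eventually_elim
      case (elim t)
      have [measurable]: "S t \<in> borel_measurable M" using S_int[of t] by auto
      have "\<epsilon> \<le> \<bar>c\<bar> * S t \<omega>" if "\<omega> \<in> space M" "\<bar>X t \<omega> - Y \<omega>\<bar> > \<epsilon>" for \<omega>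
        using bound[OF elim that(1)] that mult_right_mono[OF abs_ge_self[of c] S_nn[of t \<omega>]] by linarith
      then have "prob {\<omega> \<in> space M. \<bar>X t \<omega> - Y \<omega>\<bar> > \<epsilon>} \<le> prob {\<omega> \<in> space M. \<bar>c\<bar> * S t \<omega> \<ge> \<epsilon>}"
        by (intro finite_measure_mono) auto
      also have "\<dots> \<le> expectation (\<lambda>\<omega>. \<bar>c\<bar> * S t \<omega>) / \<epsilon>"
        using \<epsilon> S_int by (intro integral_Markov_inequality_measure[where A="{}"]) (auto simp: S_nn)
      finally show ?case by simp
    qed
    show "(\<lambda>t. \<bar>c\<bar> * expectation (S t) / \<epsilon>) \<longlonglongrightarrow> 0"
      using tendsto_divide[OF tendsto_mult_right_zero[OF S_lim, of "\<bar>c\<bar>"] tendsto_const[of \<epsilon>]] \<epsilon> by simp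
  qed auto
qed

end

subsection \<open>The received power\<close>

lemma sum_UNIV_option:
  fixes f :: "'b :: finite option \<Rightarrow> 'c :: comm_monoid_add"
  shows "(\<Sum>x\<in>UNIV. f x) = f None + (\<Sum>x\<in>UNIV. f (Some x))"
  by (simp add: UNIV_option_conv sum.reindex)

text \<open>The index \<open>None\<close> stands for the noise, \<open>Some (l', k')\<close> for the symbols of user \<open>k'\<close> in cell \<open>l'\<close>.\<close>

definition transmit_coeff ::
  "('c::finite \<Rightarrow> 'u::finite \<Rightarrow> real) \<Rightarrow> ('c \<Rightarrow> 'u \<Rightarrow> complex) \<Rightarrow> ('c \<times> 'u) option \<Rightarrow> complex" where
  "transmit_coeff \<eta> a p =
     (case p of None \<Rightarrow> 1 | Some (l', k') \<Rightarrow> complex_of_real (sqrt (\<eta> l' k')) * a l' k')"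

definition transmit_source ::
  "('c::finite \<Rightarrow> 'u::finite \<Rightarrow> nat \<Rightarrow> 'a \<Rightarrow> complex) \<Rightarrow> (nat \<Rightarrow> 'a \<Rightarrow> complex) \<Rightarrow>
   ('c \<times> 'u) option \<Rightarrow> nat \<Rightarrow> 'a \<Rightarrow> complex" where
  "transmit_source s v p = (case p of None \<Rightarrow> v | Some (l', k') \<Rightarrow> s l' k')"

text \<open>Noise counts as one more source, with coefficient 1, so the cross terms between signal
  and noise need no separate treatment.\<close>

lemma received_eq_sum_sources:
  "received \<eta> a s v n \<omega> =
     (\<Sum>p\<in>UNIV. transmit_coeff \<eta> (\<lambda>l' k'. a l' k' \<omega>) p * transmit_source s v p n \<omega>)"
  by (simp add: received_def sum_UNIV_option transmit_coeff_def transmit_source_def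
      sum.cartesian_product case_prod_unfold add.commute flip: UNIV_Times_UNIV)

text \<open>The own signal, the interference within the cell and that from other cells recombine
  into one sum over all users. Nonnegative \<eta> makes the square of \<open>sqrt\<close> equal to
  \<eta> itself.\<close>

lemma limit_power_eq_sum_sources:
  assumes "\<And>l' k'. \<eta> l' k' \<ge> 0"
  shows "limit_power \<eta> a \<sigma> l k \<omega> =
     (\<Sum>p\<in>UNIV. (cmod (transmit_coeff \<eta> (\<lambda>l' k'. a l' k' \<omega>) p))\<^sup>2 * (if p = None then \<sigma>\<^sup>2 else 1))"
proof -
  have "(\<Sum>p\<in>UNIV. (cmod (transmit_coeff \<eta> (\<lambda>l' k'. a l' k' \<omega>) p))\<^sup>2 * (if p = None then \<sigma>\<^sup>2 else 1))
      = (\<Sum>l'\<in>UNIV. \<Sum>k'\<in>UNIV. \<eta> l' k' * (cmod (a l' k' \<omega>))\<^sup>2) + \<sigma>\<^sup>2"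
    using assms
    by (simp add: sum_UNIV_option transmit_coeff_def sum.cartesian_product case_prod_unfold
        norm_mult power_mult_distrib flip: UNIV_Times_UNIV)
  also have "\<dots> = limit_power \<eta> a \<sigma> l k \<omega>"
    by (simp add: limit_power_def sum.remove[of UNIV l] sum.remove[of UNIV k])
  finally show ?thesis ..
qed

text \<open>Conditioning on the channel realizations is expressed in two ways: through conditional
  probabilities given the algebra of channels and estimates, with random gains, and by inserting
  arbitrary constant gains. Both rest on the same pathwise error bound.\<close>

theorem lemma2:
  fixes M :: "'a measure"
    and \<rho> \<sigma> :: real
    and \<eta> :: "'c::finite \<Rightarrow> 'u::finite \<Rightarrow> real"
    and g ghat :: "'c \<Rightarrow> 'c \<Rightarrow> 'u \<Rightarrow> 'a \<Rightarrow> complex ^ 'm::finite"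
    and precoder :: "'c \<Rightarrow> 'u \<Rightarrow> ('c \<times> 'c \<times> 'u \<Rightarrow> complex ^ 'm) \<Rightarrow> complex ^ 'm"
    and w :: "'c \<Rightarrow> 'u \<Rightarrow> 'a \<Rightarrow> complex ^ 'm"
    and s noise :: "'c \<Rightarrow> 'u \<Rightarrow> nat \<Rightarrow> 'a \<Rightarrow> complex"
    and \<alpha> :: "'c \<Rightarrow> 'u \<Rightarrow> 'c \<Rightarrow> 'u \<Rightarrow> 'a \<Rightarrow> complex"
    and \<tau>p :: nat
    and l :: 'c and k :: 'u
  assumes M: "prob_space M"
    and \<rho>: "\<rho> > 0"
    and \<eta>_range: "\<And>l' k'. \<eta> l' k' \<in> {0..1}"
    and \<eta>_sum: "\<And>l'. (\<Sum>k'\<in>UNIV. \<eta> l' k') \<le> 1"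
    and g: "\<And>l' i j. g l' i j \<in> borel_measurable M"
    and ghat: "\<And>l' i j. ghat l' i j \<in> borel_measurable M"
    and precoder: "\<And>l' k'. precoder l' k' \<in> PiM UNIV (\<lambda>_. borel) \<rightarrow>\<^sub>M borel"
    and w: "\<And>l' k' \<omega>. w l' k' \<omega> = precoder l' k' (all_links ghat \<omega>)"
    and \<alpha>: "\<And>i j l' k' \<omega>. \<alpha> i j l' k' \<omega> = effective_gain \<rho> (g l' i j \<omega>) (w l' k' \<omega>)"
    and s_indep: "prob_space.indep_vars M (\<lambda>_. borel) (\<lambda>(l', k', n). s l' k' n) (UNIV \<times> UNIV \<times> {1..})"
    and s_ident: "\<And>l' k' n n'. n \<ge> 1 \<Longrightarrow> n' \<ge> 1 \<Longrightarrow>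
                    distr M borel (s l' k' n) = distr M borel (s l' k' n')"
    and s_mean: "\<And>l' k' n. n \<ge> 1 \<Longrightarrow> (\<integral>\<omega>. s l' k' n \<omega> \<partial>M) = 0"
    and s_power: "\<And>l' k' n. n \<ge> 1 \<Longrightarrow> (\<integral>\<omega>. (cmod (s l' k' n \<omega>))\<^sup>2 \<partial>M) = 1"
    and noise_indep: "\<And>i j. prob_space.indep_vars M (\<lambda>_. borel) (noise i j) {1..}"
    and noise_distr: "\<And>i j n. n \<ge> 1 \<Longrightarrow> distr M borel (noise i j n) = complex_normal (\<sigma>\<^sup>2)"
    and indep: "prob_space.indep_sets M
                  (nth [sets (process_algebra M s), sets (process_algebra M noise),
                        sets (channel_algebra M g ghat)]) {..<3}"
  shows "cond_tendsto_in_prob M (channel_algebra M g ghat)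
           (mean_received_power \<tau>p (received \<eta> (\<alpha> l k) s (noise l k)))
           (limit_power \<eta> (\<alpha> l k) \<sigma> l k)
       \<and> (\<forall>a :: 'c \<Rightarrow> 'u \<Rightarrow> complex.
           tendsto_in_prob M
             (mean_received_power \<tau>p (received \<eta> (\<lambda>l' k' _. a l' k') s (noise l k)))
             (limit_power \<eta> (\<lambda>l' k' _. a l' k') \<sigma> l k))"
proof -
  interpret prob_space M by (rule M)

  \<comment> \<open>The algebras of sources and channels\<close>
  let ?F = "channel_algebra M g ghat"
  let ?A = "process_algebra M s" and ?B = "process_algebra M noise"
  define G where "G = sigma (space M) (sets ?A \<union> sets ?B)"
  define Z where "Z = transmit_source s (noise l k)"
  define P :: "('c \<times> 'u) option \<Rightarrow> real" where "P p = (if p = None then \<sigma>\<^sup>2 else 1)" for p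
  have spaces: "space ?A = space M" "space ?B = space M" "space ?F = space M"
    by (simp_all add: process_algebra_def channel_algebra_def)
  have spG: "space G = space M" by (simp add: G_def space_measure_of_conv)
  \<comment> \<open>\<open>G\<close> carries symbols and noise jointly; pairwise independence of
    each from the channels would not give this, so independence of all three algebras
    enters.\<close>
  have GF: "indep_set (sets G) (sets ?F)"
    unfolding G_def by (rule indep_set_sigma_Un[OF indep]) (simp_all add: spaces)

  \<comment> \<open>Joint independence of all sources\<close>
  have s_rv: "s l' k' n \<in> borel_measurable M" if "n \<ge> 1" for l' k' n
    using s_indep that by (auto simp: indep_vars_def)
  have noise_rv: "noise i j n \<in> borel_measurable M" if "n \<ge> 1" for i j n
    using noise_indep[of i j] that by (auto simp: indep_vars_def)

  let ?X = "\<lambda>(p, n). Z p n"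
  let ?I1 = "range (Some :: 'c \<times> 'u \<Rightarrow> _) \<times> {1::nat..}" and ?I2 = "{None :: ('c \<times> 'u) option} \<times> {1::nat..}"
  have X1: "indep_vars (\<lambda>_. borel) ?X ?I1"
  proof -
    \<comment> \<open>\<open>h\<close> strips \<open>Some\<close> and flattens the pair, matching
      the index triples of the symbols. The value of \<open>the\<close> at \<open>None\<close> does
      not matter, as \<open>?I1\<close> avoids it.\<close>
    define h :: "('c \<times> 'u) option \<times> nat \<Rightarrow> 'c \<times> 'u \<times> nat"
      where "h = (\<lambda>(p, n). (fst (the p), snd (the p), n))"
    have img: "h ` ?I1 = UNIV \<times> UNIV \<times> {1..}"
      by (force simp: h_def image_iff)
    have inj: "inj_on h ?I1"
      by (auto simp: inj_on_def h_def prod_eq_iff)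
    have "indep_vars (\<lambda>_. borel) (\<lambda>i. (\<lambda>(l', k', n). s l' k' n) (h i)) ?I1"
      by (rule indep_vars_reindex[OF s_indep[folded img] inj])
    then show ?thesis
      by (rule indep_vars_cong[THEN iffD1, rotated -1]) (auto simp: h_def Z_def transmit_source_def)
  qed
  have X2: "indep_vars (\<lambda>_. borel) ?X ?I2"
  proof -
    have img: "snd ` ?I2 = {1..}" by force
    have noise_img: "indep_vars (\<lambda>_. borel) (noise l k) (snd ` ?I2)"
      unfolding img by (rule noise_indep)
    have inj: "inj_on snd ?I2"
      by (auto simp: inj_on_def)
    have "indep_vars (\<lambda>_. borel) (\<lambda>i. noise l k (snd i)) ?I2"
      by (rule indep_vars_reindex[OF noise_img inj])
    then show ?thesis
      by (rule indep_vars_cong[THEN iffD1, rotated -1]) (auto simp: Z_def transmit_source_def)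
  qed
  have AB: "indep_set (sets ?A) (sets ?B)"
    using indep_sets_imp_indep_set[OF indep, of 0 1] by simp
  have X1_meas: "?X i \<in> borel_measurable ?A" if "i \<in> ?I1" for i
    using that borel_measurable_process_algebra[of _ s _ _ M]
    by (auto simp: Z_def transmit_source_def split: prod.splits)
  have X2_meas: "?X i \<in> borel_measurable ?B" if "i \<in> ?I2" for i
    using that borel_measurable_process_algebra[of _ noise l k M]
    by (auto simp: Z_def transmit_source_def)
  have I_Un: "?I1 \<union> ?I2 = UNIV \<times> {1..}"
    by (auto simp: image_iff)
  have Z_indep: "indep_vars (\<lambda>_. borel) ?X (UNIV \<times> {1..})"
    unfolding I_Un[symmetric]
    by (rule indep_vars_Un[OF X1 X2 _ spaces(1,2) AB X1_meas X2_meas]) auto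
  have Z_G: "Z p n \<in> borel_measurable G" if n: "n \<ge> 1" for p n
  proof -
    have sub: "sets ?A \<subseteq> sets G" "sets ?B \<subseteq> sets G"
      unfolding G_def using sets.sets_into_space[of _ ?A] sets.sets_into_space[of _ ?B]
      by (auto simp: spaces sets_measure_of_conv)
    show ?thesis
    proof (cases p)
      case None
      have "Z p n \<in> borel_measurable ?B" using X2_meas[of "(p, n)"] None n by simp
      then show ?thesis using sub(2) spaces(2) spG by (auto simp: measurable_def)
    next
      case (Some q)
      have "Z p n \<in> borel_measurable ?A" using X1_meas[of "(p, n)"] Some n by simp
      then show ?thesis using sub(1) spaces(1) spG by (auto simp: measurable_def)
    qed
  qed
  have Z_rv: "Z p n \<in> borel_measurable M" if "n \<ge> 1" for p n
    using Z_indep that by (auto simp: indep_vars_def)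

  \<comment> \<open>Laws and moments of the sources\<close>
  have noise_sq: "has_bochner_integral M (\<lambda>\<omega>. (cmod (noise l k n \<omega>))\<^sup>2) (\<sigma>\<^sup>2)" if n: "n \<ge> 1" for n
    using complex_normal_second_moment[of "\<sigma>\<^sup>2"] noise_rv[OF n]
    unfolding noise_distr[OF n, of l k, symmetric]
    by (simp add: has_bochner_integral_iff integrable_distr_eq integral_distr)
  have Z_ident: "distr M borel (Z p n) = distr M borel (Z p 1)" if n: "n \<ge> 1" for p n
  proof (cases p)
    case None
    then show ?thesis using noise_distr[OF n, of l k] noise_distr[of 1 l k] by (simp add: Z_def transmit_source_def)
  next
    case (Some q)
    then show ?thesis using s_ident[OF n, of 1 "fst q" "snd q"] by (simp add: Z_def transmit_source_def case_prod_unfold)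
  qed
  have Z_sq: "has_bochner_integral M (\<lambda>\<omega>. (cmod (Z p n \<omega>))\<^sup>2) (P p)" if n: "n \<ge> 1" for p n
  proof (cases p)
    case None
    then show ?thesis using noise_sq[OF n] by (simp add: Z_def transmit_source_def P_def)
  next
    case (Some q)
    \<comment> \<open>The Bochner integral of a non-integrable function is 0 by convention, so unit
      power already forces integrability.\<close>
    have "(\<integral>\<omega>. (cmod (s (fst q) (snd q) n \<omega>))\<^sup>2 \<partial>M) \<noteq> 0"
      using s_power[OF n] by simp
    then have "integrable M (\<lambda>\<omega>. (cmod (s (fst q) (snd q) n \<omega>))\<^sup>2)"
      using not_integrable_integral_eq by blast
    then show ?thesis
      using Some s_power[OF n, of "fst q" "snd q"]
      by (simp add: has_bochner_integral_iff Z_def transmit_source_def P_def case_prod_unfold)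
  qed
  \<comment> \<open>Only \<open>None\<close> is noise, so of two distinct indices at least one is a
    symbol stream, whose mean is 0.\<close>
  have Z_uncor: "expectation (Z p 1) * cnj (expectation (Z q 1)) = 0" if "p \<noteq> q" for p q
    using that s_mean[of 1] by (cases p; cases q) (auto simp: Z_def transmit_source_def split: prod.splits)
  have cross_int: "integrable M (\<lambda>\<omega>. Z p n \<omega> * cnj (Z q n \<omega>))" if "n \<ge> 1" for p q n
    by (rule weak_law_cross_moments(1)[OF Z_indep Z_ident _ Z_uncor _ that])
      (use Z_sq in \<open>auto simp: has_bochner_integral_iff\<close>)

  \<comment> \<open>Sample correlation errors and their convergence in mean\<close>
  define R where "R p q N \<omega> = cmod ((\<Sum>n=1..N. Z p n \<omega> * cnj (Z q n \<omega>)) / of_nat N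
      - (if p = q then of_real (P p) else 0))" for p q N \<omega>
  \<comment> \<open>\<open>S\<close> involves the sources but not the gains, hence is measurable for
    \<open>G\<close>. The subtraction is truncated: up to \<open>\<tau>p\<close> the number of
    samples is 0.\<close>
  define S where "S t \<omega> = (\<Sum>p\<in>UNIV. \<Sum>q\<in>UNIV. R p q (t - \<tau>p) \<omega>)" for t \<omega>
  have R_lim: "(\<lambda>N. expectation (R p q N)) \<longlonglongrightarrow> 0" for p q
    unfolding R_def
    by (rule weak_law_cross_moments(2)[OF Z_indep Z_ident _ Z_uncor])
      (use Z_sq in \<open>auto simp: has_bochner_integral_iff\<close>)
  have R_int: "integrable M (R p q N)" for p q N
    unfolding R_def
    by (intro integrable_norm Bochner_Integration.integrable_diff integrable_divide_zero impI
        Bochner_Integration.integrable_sum cross_int integrable_const) auto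
  have R_G [measurable]: "R p q N \<in> borel_measurable G" for p q N
    unfolding R_def
    by (intro measurable_compose[OF _ borel_measurable_norm] borel_measurable_diff borel_measurable_divide
        borel_measurable_sum borel_measurable_times measurable_compose[OF Z_G borel_measurable_cnj] Z_G) auto
  have S_nn: "S t \<omega> \<ge> 0" for t \<omega> by (simp add: S_def R_def sum_nonneg)
  have S_int: "integrable M (S t)" for t
    unfolding S_def by (intro Bochner_Integration.integrable_sum R_int)
  have S_G: "S t \<in> borel_measurable G" for t unfolding S_def by measurable
  have S_lim: "(\<lambda>t. expectation (S t)) \<longlonglongrightarrow> 0"
  proof -
    have "expectation (S t) = (\<Sum>p\<in>UNIV. \<Sum>q\<in>UNIV. expectation (R p q (t - \<tau>p)))" for t
      unfolding S_def by (simp add: Bochner_Integration.integral_sum R_int)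
    moreover have "(\<lambda>t. \<Sum>p\<in>UNIV. \<Sum>q\<in>UNIV. expectation (R p q (t - \<tau>p))) \<longlonglongrightarrow> 0"
      by (intro tendsto_null_sum filterlim_compose[OF R_lim] filterlim_minus_const_nat_at_top)
    ultimately show ?thesis by simp
  qed

  \<comment> \<open>The pathwise error bound, with a factor depending only on the gains\<close>
  define W where "W a = (\<Sum>p\<in>UNIV. \<Sum>q\<in>UNIV. cmod (transmit_coeff \<eta> a p * cnj (transmit_coeff \<eta> a q)))" for a
  have bound: "\<bar>mean_received_power \<tau>p (received \<eta> a s (noise l k)) t \<omega> - limit_power \<eta> a \<sigma> l k \<omega>\<bar>
      \<le> W (\<lambda>l' k'. a l' k' \<omega>) * S t \<omega>" for a t \<omega>
    using mean_square_norm_sum_bound[of "t - \<tau>p" "transmit_coeff \<eta> (\<lambda>l' k'. a l' k' \<omega>)" "\<lambda>p n. Z p n \<omega>" P]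
      limit_power_eq_sum_sources[of \<eta> a \<sigma> l k \<omega>] \<eta>_range
    by (simp add: mean_received_power_def received_eq_sum_sources W_def S_def R_def Z_def P_def)

  \<comment> \<open>Measurability of the powers and the gains\<close>
  have mean_rv: "mean_received_power \<tau>p (received \<eta> a s (noise l k)) t \<in> borel_measurable M"
    if [measurable]: "\<And>l' k'. a l' k' \<in> borel_measurable M" for a t
  proof -
    have [measurable]: "received \<eta> a s (noise l k) n \<in> borel_measurable M" if "n \<ge> 1" for n
    proof -
      note [measurable] = s_rv[OF that] noise_rv[OF that]
      show ?thesis unfolding received_def by measurable
    qed
    have "(\<lambda>\<omega>. \<Sum>n=1..t - \<tau>p. (cmod (received \<eta> a s (noise l k) n \<omega>))\<^sup>2) \<in> borel_measurable M"
      by (rule borel_measurable_sum) (simp add: measurable_compose)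
    then show ?thesis unfolding mean_received_power_def by measurable
  qed
  have limit_rv: "limit_power \<eta> a \<sigma> l k \<in> borel_measurable M"
    if [measurable]: "\<And>l' k'. a l' k' \<in> borel_measurable M" for a
    unfolding limit_power_def by measurable

  have links_rv: "(\<lambda>\<omega>. (all_links g \<omega>, all_links ghat \<omega>)) \<in> measurable M (PiM UNIV (\<lambda>_. borel) \<Otimes>\<^sub>M PiM UNIV (\<lambda>_. borel))"
    by (intro measurable_Pair measurable_PiM_single') (auto simp: all_links_def g ghat split: prod.splits)
  have sub: "subalgebra M ?F"
    using links_rv unfolding subalgebra_def channel_algebra_def measurable_iff_sets by simp
  have links_F: "(\<lambda>\<omega>. (all_links g \<omega>, all_links ghat \<omega>)) \<in> measurable ?F (PiM UNIV (\<lambda>_. borel) \<Otimes>\<^sub>M PiM UNIV (\<lambda>_. borel))"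
    unfolding channel_algebra_def by (rule measurable_vimage_algebra1) (auto simp: space_PiM space_pair_measure)
  have \<alpha>_F: "\<alpha> l k l' k' \<in> borel_measurable ?F" for l' k'
  proof -
    have nth [measurable]: "(\<lambda>x :: complex ^ 'm. x $ i) \<in> borel_measurable borel" for i
      by (intro borel_measurable_continuous_onI continuous_intros)
    have gF [measurable]: "g l' l k \<in> borel_measurable ?F"
      using measurable_compose[OF measurable_compose[OF links_F measurable_fst] measurable_component_singleton[of "(l', l, k)"]]
      by (simp add: all_links_def)
    \<comment> \<open>The precoding vector is a measurable function of the channel estimates, which
      is why the conditioning algebra contains them besides the channels.\<close>
    have wF [measurable]: "w l' k' \<in> borel_measurable ?F"
      using measurable_compose[OF measurable_compose[OF links_F measurable_snd] precoder[of l' k']]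
      unfolding w[abs_def] by simp
    have "(\<lambda>\<omega>. effective_gain \<rho> (g l' l k \<omega>) (w l' k' \<omega>)) \<in> borel_measurable ?F"
      unfolding effective_gain_def by measurable
    then show ?thesis by (simp add: \<alpha>[abs_def])
  qed
  have \<alpha>_rv: "\<alpha> l k l' k' \<in> borel_measurable M" for l' k'
    by (rule measurable_from_subalg[OF sub \<alpha>_F])
  have W_F: "(\<lambda>\<omega>. W (\<lambda>l' k'. \<alpha> l k l' k' \<omega>)) \<in> borel_measurable ?F"
  proof -
    have [measurable]: "(\<lambda>\<omega>. transmit_coeff \<eta> (\<lambda>l' k'. \<alpha> l k l' k' \<omega>) p) \<in> borel_measurable ?F" for p
      using \<alpha>_F by (cases p) (auto simp: transmit_coeff_def split: prod.splits)
    show ?thesis unfolding W_def by measurable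
  qed

  \<comment> \<open>Convergence given the channels and for constant gains\<close>
  show ?thesis
  proof (intro conjI allI)
    show "cond_tendsto_in_prob M ?F (mean_received_power \<tau>p (received \<eta> (\<alpha> l k) s (noise l k)))
        (limit_power \<eta> (\<alpha> l k) \<sigma> l k)"
      by (rule cond_tendsto_in_prob_product_bound[OF sub mean_rv[OF \<alpha>_rv] limit_rv[OF \<alpha>_rv] W_F bound
            S_nn S_int S_lim S_G spG GF])
  next
    fix a :: "'c \<Rightarrow> 'u \<Rightarrow> complex"
    show "tendsto_in_prob M (mean_received_power \<tau>p (received \<eta> (\<lambda>l' k' _. a l' k') s (noise l k)))
        (limit_power \<eta> (\<lambda>l' k' _. a l' k') \<sigma> l k)"
      by (rule tendsto_in_prob_product_bound[OF mean_rv limit_rv bound[of "\<lambda>l' k' _. a l' k'"] S_nn S_int S_lim]) auto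
  qed
qed

end
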